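(* For each $n\ge 1$ there is a constant $C(n)$ such that the following holds. Suppose $X$ is a CW-complex embedded in $\mathbb{R}^n$ with retraction thickness at least $T>0$. Let $V$ be the volume of the $T$-neighborhood of $X$. Then $$\operatorname{Rank} H_*(X)\le C(n)\,V\,T^{-n}.$$
   Context: $\operatorname{Rank} H_*(X)$ is the sum over all degrees of the ranks of the homology groups of $X$ (the sum of the Betti numbers). A topologically embedded complex $X\subset\mathbb{R}^n$ has retraction thickness at least $T$ if the $T$-neighborhood $N_T(X)=\{y\in\mathbb{R}^n: \mathrm{dist}(y,X)<T\}$ retracts to $X$, i.e. there is a continuous map $N_T(X)\to X$ that is the identity on $X$. *)

theory Defs
  imports "HOL-Analysis.Analysis" "HOL-Homology.Homology"
begin

definition closed_disk :: "nat \<Rightarrow> (nat \<Rightarrow> real) set"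
  where "closed_disk k = {x \<in> topspace (Euclidean_space k). (\<Sum>i<k. (x i)\<^sup>2) \<le> 1}"

definition open_disk :: "nat \<Rightarrow> (nat \<Rightarrow> real) set"
  where "open_disk k = {x \<in> topspace (Euclidean_space k). (\<Sum>i<k. (x i)\<^sup>2) < 1}"

definition boundary_sphere :: "nat \<Rightarrow> (nat \<Rightarrow> real) set"
  where "boundary_sphere k = {x \<in> topspace (Euclidean_space k). (\<Sum>i<k. (x i)\<^sup>2) = 1}"

(* E is the set of open cells, d e the dimension and \<Phi> e the characteristic map of the cell e.
   Cells are disjoint and nonempty, so indexing by the cells themselves loses nothing.
   The last two conditions are closure-finiteness and the weak topology. *)
definition cw_structure ::
    "'a topology \<Rightarrow> 'a set set \<Rightarrow> ('a set \<Rightarrow> nat) \<Rightarrow> ('a set \<Rightarrow> (nat \<Rightarrow> real) \<Rightarrow> 'a) \<Rightarrow> bool"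
  where "cw_structure X E d \<Phi> \<longleftrightarrow>
    Hausdorff_space X \<and>
    disjoint E \<and> \<Union>E = topspace X \<and>
    (\<forall>e\<in>E. continuous_map (subtopology (Euclidean_space (d e)) (closed_disk (d e))) X (\<Phi> e)) \<and>
    (\<forall>e\<in>E. homeomorphic_map (subtopology (Euclidean_space (d e)) (open_disk (d e)))
              (subtopology X e) (\<Phi> e)) \<and>
    (\<forall>e\<in>E. \<exists>F\<subseteq>E. finite F \<and> (\<forall>c\<in>F. d c < d e) \<and> \<Phi> e ` boundary_sphere (d e) \<subseteq> \<Union>F) \<and>
    (\<forall>A\<subseteq>topspace X. closedin X A \<longleftrightarrow> (\<forall>e\<in>E. closedin X (A \<inter> \<Phi> e ` closed_disk (d e))))"

definition cw_complex :: "'a topology \<Rightarrow> bool"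
  where "cw_complex X \<longleftrightarrow> (\<exists>E d \<Phi>. cw_structure X E d \<Phi>)"

(* Rank of an abelian group, written multiplicatively: the supremum of the cardinalities
   of finite integrally independent subsets. *)
definition int_independent :: "('a, 'b) monoid_scheme \<Rightarrow> 'a set \<Rightarrow> bool"
  where "int_independent G B \<longleftrightarrow>
    (\<forall>c :: 'a \<Rightarrow> int. finprod G (\<lambda>b. b [^]\<^bsub>G\<^esub> c b) B = \<one>\<^bsub>G\<^esub> \<longrightarrow> (\<forall>b\<in>B. c b = 0))"

definition abelian_rank :: "('a, 'b) monoid_scheme \<Rightarrow> enat"
  where "abelian_rank G =
    (SUP B \<in> {B. finite B \<and> B \<subseteq> carrier G \<and> int_independent G B}. enat (card B))"

(* Negative degrees are omitted: there the library's homology groups are trivial. *)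
definition rank_homology :: "'a topology \<Rightarrow> ennreal"
  where "rank_homology X = suminf (\<lambda>p. ennreal_of_enat (abelian_rank (homology_group (int p) X)))"

(* The guard is needed because infdist y {} = 0, while the distance to the empty set is infinite. *)
definition open_neighborhood :: "real \<Rightarrow> 'a::metric_space set \<Rightarrow> 'a set"
  where "open_neighborhood T X = {y. X \<noteq> {} \<and> infdist y X < T}"

definition retraction_thickness_at_least :: "real \<Rightarrow> 'a::metric_space set \<Rightarrow> bool"
  where "retraction_thickness_at_least T X \<longleftrightarrow> X retract_of open_neighborhood T X"

end

(*
  Cover X by enlarged open cells of a cubical grid of mesh s = T/(2n), one for each cell that
  contains a point of X. Their union U lies between X and the T-neighborhood N, so X is a retract
  of U and its homology embeds in that of U. The unenlarged cells are disjoint subsets of N of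
  volume s^n, so there are at most V/s^n of them. Finally, for open sets
  b(A Un B) <= b(A) + b(B) + b(A Int B), where b is the total Betti number. Adding the boxes one at
  a time, each of which meets at most 5^n of them, and using that intersections of boxes are convex
  or empty, bounds b(U) by 2^(5^n) times the number of boxes.
*)

theory Submission
  imports Defs
begin

section \<open>Rank of abelian groups\<close>

definition int_comb :: "('a, 'b) monoid_scheme \<Rightarrow> ('i \<Rightarrow> int) \<Rightarrow> ('i \<Rightarrow> 'a) \<Rightarrow> 'i set \<Rightarrow> 'a"
  where "int_comb G c x I = finprod G (\<lambda>i. x i [^]\<^bsub>G\<^esub> c i) I"

text \<open>Indexed families instead of sets: images under a homomorphism and chosen lifts may
  coincide a priori, and a family keeps such repetitions visible as relations.\<close>

definition indep_family :: "('a, 'b) monoid_scheme \<Rightarrow> ('i \<Rightarrow> 'a) \<Rightarrow> 'i set \<Rightarrow> bool"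
  where "indep_family G x I \<longleftrightarrow>
    (\<forall>c. int_comb G c x I = \<one>\<^bsub>G\<^esub> \<longrightarrow> (\<forall>i\<in>I. c i = 0))"

lemma indep_familyD: "indep_family G x I \<Longrightarrow> int_comb G c x I = \<one>\<^bsub>G\<^esub> \<Longrightarrow> i \<in> I \<Longrightarrow> c i = 0"
  by (auto simp: indep_family_def)

context comm_group
begin

lemma int_comb_empty [simp]: "int_comb G c x {} = \<one>"
  by (simp add: int_comb_def)

lemma int_comb_insert:
  assumes "finite I" "i \<notin> I" "x \<in> insert i I \<rightarrow> carrier G"
  shows "int_comb G c x (insert i I) = x i [^] c i \<otimes> int_comb G c x I"
  unfolding int_comb_def using assms by (subst finprod_insert) auto

lemma int_comb_closed [simp]: "x \<in> I \<rightarrow> carrier G \<Longrightarrow> int_comb G c x I \<in> carrier G"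
  by (auto simp: int_comb_def intro!: finprod_closed)

lemma int_comb_cong:
  assumes "\<And>i. i \<in> I \<Longrightarrow> c i = d i" "\<And>i. i \<in> I \<Longrightarrow> x i = y i" "y \<in> I \<rightarrow> carrier G"
  shows "int_comb G c x I = int_comb G d y I"
  unfolding int_comb_def using assms by (intro finprod_cong') auto

lemma int_comb_add:
  assumes "x \<in> I \<rightarrow> carrier G"
  shows "int_comb G (\<lambda>i. c i + d i) x I = int_comb G c x I \<otimes> int_comb G d x I"
proof -
  have "int_comb G (\<lambda>i. c i + d i) x I = finprod G (\<lambda>i. x i [^] c i \<otimes> x i [^] d i) I"
    unfolding int_comb_def using assms by (intro finprod_cong') (auto simp: int_pow_mult Pi_iff)
  also have "\<dots> = int_comb G c x I \<otimes> int_comb G d x I"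
    unfolding int_comb_def using assms by (intro finprod_multf) auto
  finally show ?thesis .
qed

lemma int_comb_pow:
  assumes "finite I" "x \<in> I \<rightarrow> carrier G"
  shows "int_comb G c x I [^] (n::int) = int_comb G (\<lambda>i. n * c i) x I"
  using assms
proof (induction I)
  case (insert i I)
  then show ?case
    by (simp add: int_comb_insert int_pow_distrib int_pow_pow mult.commute)
qed simp

lemma int_comb_zero: "x \<in> I \<rightarrow> carrier G \<Longrightarrow> (\<And>i. i \<in> I \<Longrightarrow> c i = 0) \<Longrightarrow> int_comb G c x I = \<one>"
  unfolding int_comb_def by (rule finprod_one_eqI) simp

lemma int_comb_mono_neutral:
  assumes "finite I" "J \<subseteq> I" "x \<in> I \<rightarrow> carrier G" "\<And>i. i \<in> I - J \<Longrightarrow> c i = 0"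
  shows "int_comb G c x J = int_comb G c x I"
  unfolding int_comb_def
  by (rule finprod_mono_neutral_cong_left) (use assms in \<open>auto simp: Pi_iff\<close>)

lemma int_comb_int_comb:
  assumes "finite T" "finite I" "x \<in> I \<rightarrow> carrier G"
  shows "int_comb G e (\<lambda>s. int_comb G (c s) x I) T = int_comb G (\<lambda>i. \<Sum>s\<in>T. e s * c s i) x I"
  using assms(1)
proof (induction T)
  case empty
  then show ?case using assms by (simp add: int_comb_zero)
next
  case (insert t T)
  then show ?case
    using assms by (simp add: int_comb_insert int_comb_pow int_comb_add)
qed

lemma hom_int_comb:
  assumes "comm_group H" "f \<in> hom G H" "finite I" "x \<in> I \<rightarrow> carrier G"
  shows "f (int_comb G c x I) = int_comb H c (\<lambda>i. f (x i)) I"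
  using assms(3,4)
proof (induction I)
  case empty
  interpret H: comm_group H by fact
  show ?case
    using assms by (simp add: hom_one)
next
  case (insert i I)
  interpret H: comm_group H by fact
  have "f (x i [^] c i) = f (x i) [^]\<^bsub>H\<^esub> c i"
    using assms insert by (intro hom_int_pow) auto
  moreover have "(\<lambda>i. f (x i)) \<in> insert i I \<rightarrow> carrier H"
    using assms insert by (auto simp: hom_def)
  ultimately show ?case
    using insert assms(2) by (simp add: int_comb_insert H.int_comb_insert hom_mult)
qed

text \<open>A repeated value \<open>x i = x j\<close> would give the nontrivial relation with
  coefficient 1 at \<open>i\<close> and -1 at \<open>j\<close>.\<close>

lemma indep_family_imp_inj_on:
  assumes "finite I" "x \<in> I \<rightarrow> carrier G" "indep_family G x I"
  shows "inj_on x I"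
proof (rule inj_onI, rule ccontr)
  fix i j assume ij: "i \<in> I" "j \<in> I" "x i = x j" "i \<noteq> j"
  define c :: "_ \<Rightarrow> int" where "c k = (if k = i then 1 else if k = j then -1 else 0)" for k
  have "int_comb G c x I = int_comb G c x {i, j}"
    using assms ij by (intro int_comb_mono_neutral[symmetric]) (auto simp: c_def)
  also have "\<dots> = x i [^] c i \<otimes> x j [^] c j"
    using assms ij by (subst int_comb_insert) (auto simp: int_comb_insert Pi_iff)
  also have "\<dots> = \<one>"
    using assms ij by (auto simp: c_def int_pow_neg Pi_iff)
  finally have "c i = 0"
    using assms ij indep_familyD by metis
  then show False by (simp add: c_def)
qed

text \<open>Bridge from families back to the sets in \<open>abelian_rank\<close>: by injectivity,
  the set of values is as large as the index set and inherits independence.\<close>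

lemma indep_family_card_le_rank:
  assumes "finite I" "x \<in> I \<rightarrow> carrier G" "indep_family G x I"
  shows "enat (card I) \<le> abelian_rank G"
proof -
  have inj: "inj_on x I"
    using assms by (rule indep_family_imp_inj_on)
  have "int_independent G (x ` I)"
    unfolding int_independent_def
  proof (intro allI impI)
    fix c :: "'a \<Rightarrow> int"
    assume "finprod G (\<lambda>b. b [^] c b) (x ` I) = \<one>"
    moreover have "finprod G (\<lambda>b. b [^] c b) (x ` I) = int_comb G (\<lambda>i. c (x i)) x I"
      unfolding int_comb_def using assms inj by (intro finprod_reindex) auto
    ultimately show "\<forall>b\<in>x ` I. c b = 0"
      using indep_familyD[OF assms(3), of "\<lambda>i. c (x i)"] by auto
  qed
  then have "enat (card (x ` I)) \<le> abelian_rank G"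
    unfolding abelian_rank_def using assms by (intro SUP_upper) auto
  then show ?thesis
    using inj by (simp add: card_image)
qed

end

section \<open>Rank under injections and in exact sequences, and two basic ranks\<close>

lemma abelian_rank_leI:
  assumes "\<And>S. finite S \<Longrightarrow> S \<subseteq> carrier G \<Longrightarrow> indep_family G (\<lambda>s. s) S \<Longrightarrow> enat (card S) \<le> r"
  shows "abelian_rank G \<le> r"
  unfolding abelian_rank_def
  by (rule SUP_least) (use assms in \<open>auto simp: indep_family_def int_comb_def int_independent_def\<close>)

text \<open>Injectivity pulls every relation among the images back to the same relation in
  \<open>G\<close>.\<close>

lemma abelian_rank_le_of_inj_hom:
  assumes "comm_group G" "comm_group H" "f \<in> hom G H" "inj_on f (carrier G)"
  shows "abelian_rank G \<le> abelian_rank H"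
proof (rule abelian_rank_leI)
  interpret G: comm_group G by fact
  interpret H: comm_group H by fact
  fix S assume S: "finite S" "S \<subseteq> carrier G" "indep_family G (\<lambda>s. s) S"
  have "indep_family H f S"
    unfolding indep_family_def
  proof (intro allI impI)
    fix c assume "int_comb H c f S = \<one>\<^bsub>H\<^esub>"
    then have "f (int_comb G c (\<lambda>s. s) S) = f \<one>\<^bsub>G\<^esub>"
      using S assms(2,3) by (subst G.hom_int_comb) (auto simp: hom_one)
    moreover have "int_comb G c (\<lambda>s. s) S \<in> carrier G"
      using S by (intro G.int_comb_closed) auto
    ultimately have "int_comb G c (\<lambda>s. s) S = \<one>\<^bsub>G\<^esub>"
      using assms(4) by (auto simp: inj_on_eq_iff)
    then show "\<forall>i\<in>S. c i = 0"
      using S(3) by (auto simp: indep_family_def)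
  qed
  then show "enat (card S) \<le> abelian_rank H"
    using S assms(3) by (intro H.indep_family_card_le_rank) (auto simp: hom_def)
qed

text \<open>An integral form of rank-nullity, meant for three consecutive terms of the long exact
  sequence of a pair. Nonzero multiples take the place of division.\<close>

lemma abelian_rank_exact:
  assumes "comm_group A" "comm_group B" "comm_group C" "f \<in> hom A B" "g \<in> hom B C"
    and exact: "kernel B C g \<subseteq> f ` carrier A"
  shows "abelian_rank B \<le> abelian_rank A + abelian_rank C"
proof (rule abelian_rank_leI)
  interpret A: comm_group A by fact
  interpret B: comm_group B by fact
  interpret C: comm_group C by fact
  have f: "f x \<in> carrier B" if "x \<in> carrier A" for x
    using assms(4) that by (auto simp: hom_def)
  have g: "g x \<in> carrier C" if "x \<in> carrier B" for x
    using assms(5) that by (auto simp: hom_def)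
  fix S assume S: "finite S" "S \<subseteq> carrier B" "indep_family B (\<lambda>s. s) S"
  txt \<open>
    Split \<open>S\<close> into a maximal part \<open>M\<close> whose image in \<open>C\<close> stays independent, and the rest: each
    \<open>s \<in> S - M\<close> has a nonzero multiple which, corrected by a combination of \<open>M\<close>, lies in the kernel
    of \<open>g\<close> and hence lifts to some \<open>a s\<close> in \<open>A\<close>.
  \<close>
  have "finite {S1. S1 \<subseteq> S \<and> indep_family C g S1}" "{} \<in> {S1. S1 \<subseteq> S \<and> indep_family C g S1}"
    using S by (auto simp: indep_family_def)
  then obtain M where M: "M \<subseteq> S" "indep_family C g M"
    and max: "\<And>S1. S1 \<subseteq> S \<Longrightarrow> indep_family C g S1 \<Longrightarrow> M \<subseteq> S1 \<Longrightarrow> M = S1"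
    using finite_has_maximal2[of "{S1. S1 \<subseteq> S \<and> indep_family C g S1}" "{}"] by auto
  have finM: "finite M" using M S finite_subset by blast
  have "\<exists>c a. c s \<noteq> 0 \<and> (\<forall>s'\<in>S-M. s' \<noteq> s \<longrightarrow> c s' = 0) \<and> a \<in> carrier A \<and> f a = int_comb B c (\<lambda>s. s) S"
    if s: "s \<in> S - M" for s
  proof -
    have "\<not> indep_family C g (insert s M)"
      using max[of "insert s M"] s M(1) by auto
    then obtain c where c: "int_comb C c g (insert s M) = \<one>\<^bsub>C\<^esub>" "\<exists>i\<in>insert s M. c i \<noteq> 0"
      by (auto simp: indep_family_def)
    have gC: "g \<in> insert s M \<rightarrow> carrier C"
      using g s M S by auto
    \<comment> \<open>Otherwise the nontrivial relation would involve only \<open>M\<close>, whose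
      image is independent.\<close>
    have "c s \<noteq> 0"
    proof
      assume "c s = 0"
      then have "int_comb C c g M = \<one>\<^bsub>C\<^esub>"
        using c(1) s gC finM by (subst (asm) C.int_comb_insert) auto
      then show False
        using indep_familyD[OF M(2)] c(2) \<open>c s = 0\<close> by auto
    qed
    \<comment> \<open>Extension by zero makes the relation a combination over all of
      \<open>S\<close>, the form to which independence of \<open>S\<close> applies.\<close>
    define d where "d i = (if i \<in> insert s M then c i else 0)" for i
    have "g (int_comb B d (\<lambda>s. s) S) = int_comb C d g S"
      using S assms(3,5) by (subst B.hom_int_comb) auto
    also have "\<dots> = int_comb C d g (insert s M)"
      using S M s g by (intro C.int_comb_mono_neutral[symmetric]) (auto simp: d_def)
    also have "\<dots> = int_comb C c g (insert s M)"
      using gC by (intro C.int_comb_cong) (auto simp: d_def)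
    finally have "int_comb B d (\<lambda>s. s) S \<in> kernel B C g"
      using c(1) S by (auto simp: kernel_def intro!: B.int_comb_closed)
    then obtain a where "a \<in> carrier A" "int_comb B d (\<lambda>s. s) S = f a"
      using exact by auto
    then show ?thesis
      using \<open>c s \<noteq> 0\<close> s by (intro exI[of _ d] exI[of _ a]) (auto simp: d_def)
  qed
  then obtain c a where c: "\<And>s. s \<in> S - M \<Longrightarrow> c s s \<noteq> (0::int)"
      "\<And>s s'. s \<in> S - M \<Longrightarrow> s' \<in> S - M \<Longrightarrow> s' \<noteq> s \<Longrightarrow> c s s' = 0"
    and a: "\<And>s. s \<in> S - M \<Longrightarrow> a s \<in> carrier A"
      "\<And>s. s \<in> S - M \<Longrightarrow> f (a s) = int_comb B (c s) (\<lambda>s. s) S"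
    by metis
  have "indep_family A a (S - M)"
    unfolding indep_family_def
  proof (intro allI impI ballI)
    fix e t assume e: "int_comb A e a (S - M) = \<one>\<^bsub>A\<^esub>" and t: "t \<in> S - M"
    have "\<one>\<^bsub>B\<^esub> = f (int_comb A e a (S - M))"
      using e assms(4) by (simp add: hom_one)
    also have "\<dots> = int_comb B e (\<lambda>s. f (a s)) (S - M)"
      using S a assms(2,4) by (subst A.hom_int_comb) auto
    also have "\<dots> = int_comb B e (\<lambda>s. int_comb B (c s) (\<lambda>s. s) S) (S - M)"
      using S a by (intro B.int_comb_cong) (auto intro!: B.int_comb_closed)
    also have "\<dots> = int_comb B (\<lambda>i. \<Sum>s\<in>S-M. e s * c s i) (\<lambda>s. s) S"
      using S by (intro B.int_comb_int_comb) auto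
    \<comment> \<open>Independence of \<open>S\<close> kills the coefficient at \<open>t\<close>. On
      \<open>S - M\<close> the matrix \<open>c\<close> is diagonal with nonzero entries, so this
      coefficient is just \<open>e t * c t t\<close>.\<close>
    finally have "(\<Sum>s\<in>S-M. e s * c s t) = 0"
      using S(3) t by (metis (no_types, lifting) DiffD1 indep_familyD)
    moreover have "(\<Sum>s\<in>S-M. e s * c s t) = (\<Sum>s\<in>{t}. e s * c s t)"
      using S t c by (intro sum.mono_neutral_right) auto
    ultimately show "e t = 0"
      using c t by auto
  qed
  then have "enat (card (S - M)) \<le> abelian_rank A"
    using S a by (intro A.indep_family_card_le_rank) auto
  moreover have "enat (card M) \<le> abelian_rank C"
    using M S g finM by (intro C.indep_family_card_le_rank[of _ g]) auto
  moreover have "enat (card S) = enat (card (S - M)) + enat (card M)"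
    using M S finM by (simp add: card_Diff_subset card_mono)
  ultimately show "enat (card S) \<le> abelian_rank A + abelian_rank C"
    by (metis add_mono)
qed

lemma abelian_rank_trivial:
  assumes "comm_group G" "trivial_group G"
  shows "abelian_rank G = 0"
proof -
  interpret comm_group G by fact
  have "enat (card S) \<le> 0" if S: "S \<subseteq> carrier G" "indep_family G (\<lambda>s. s) S" for S
  proof -
    \<comment> \<open>In a trivial group even the combination with all coefficients 1 vanishes, so
      an independent set has no elements.\<close>
    have "int_comb G (\<lambda>_. 1) (\<lambda>s. s) S \<in> carrier G"
      using S by (intro int_comb_closed) auto
    then have "int_comb G (\<lambda>_. 1) (\<lambda>s. s) S = \<one>\<^bsub>G\<^esub>"
      using assms(2) by (auto simp: trivial_group_def)
    then have "S = {}"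
      using indep_familyD[OF S(2)] by force
    then show ?thesis by (simp add: zero_enat_def)
  qed
  then have "abelian_rank G \<le> 0"
    by (intro abelian_rank_leI) auto
  then show ?thesis by simp
qed

lemma abelian_rank_integer_group: "abelian_rank integer_group \<le> 1"
proof (rule abelian_rank_leI)
  interpret comm_group integer_group by (rule abelian_integer_group)
  fix S assume S: "finite S" "S \<subseteq> carrier integer_group" "indep_family integer_group (\<lambda>s. s) S"
  have "a = b" if ab: "a \<in> S" "b \<in> S" for a b
  proof (rule ccontr)
    assume "a \<noteq> b"
    \<comment> \<open>The relation b * a - a * b = 0 forces both integers to be 0, hence
      equal.\<close>
    define c where "c k = (if k = a then b else if k = b then -a else 0)" for k
    have "int_comb integer_group c (\<lambda>s. s) S = int_comb integer_group c (\<lambda>s. s) {a, b}"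
      using S ab by (intro int_comb_mono_neutral[symmetric]) (auto simp: c_def)
    also have "\<dots> = 0"
      using \<open>a \<noteq> b\<close> by (simp add: int_comb_insert c_def)
    finally have "c a = 0" "c b = 0"
      using indep_familyD[OF S(3), of c] ab by auto
    then show False
      using \<open>a \<noteq> b\<close> by (auto simp: c_def split: if_splits)
  qed
  then have "card S \<le> 1"
    using S(1) by (auto simp: card_le_Suc0_iff_eq)
  then show "enat (card S) \<le> 1"
    by (simp add: one_enat_def)
qed


section \<open>Total Betti number\<close>

lemma rank_homology_le:
  assumes "\<And>p::nat. abelian_rank (homology_group (int p) X) \<le> abelian_rank (homology_group (int p) Y)"
  shows "rank_homology X \<le> rank_homology Y"
  unfolding rank_homology_def by (intro suminf_le) (auto simp: assms)

lemma rank_homology_empty: "topspace X = {} \<Longrightarrow> rank_homology X = 0"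
  by (simp add: rank_homology_def abelian_rank_trivial abelian_homology_group
      trivial_homology_group_empty)

text \<open>The retraction induces a left inverse to the map induced by inclusion, which is
  therefore injective in every degree.\<close>

lemma rank_homology_retract:
  assumes "S retract_of_space X"
  shows "rank_homology (subtopology X S) \<le> rank_homology X"
  by (rule rank_homology_le, rule abelian_rank_le_of_inj_hom
      [OF abelian_homology_group abelian_homology_group hom_induced_hom inj_on_hom_induced_inclusion])
    (use assms in simp)

lemma abelian_rank_iso:
  assumes "comm_group G" "comm_group H" "G \<cong> H"
  shows "abelian_rank G \<le> abelian_rank H"
proof -
  obtain f where "f \<in> iso G H"
    using assms(3) by (auto simp: is_iso_def)
  then show ?thesis
    using assms by (intro abelian_rank_le_of_inj_hom[of G H f]) (auto simp: iso_def bij_betw_def)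
qed

lemma rank_homology_contractible:
  assumes "contractible_space X"
  shows "rank_homology X \<le> 1"
proof (cases "topspace X = {}")
  \<comment> \<open>The empty space counts as contractible, so the bound 1 need not be attained.
    This is convenient for empty intersections of convex sets.\<close>
  case True
  then show ?thesis by (simp add: rank_homology_empty)
next
  case False
  then obtain a where a: "a \<in> topspace X" "X homotopy_equivalent_space (subtopology X {a})"
    using assms by (auto simp: contractible_eq_homotopy_equivalent_singleton_subtopology)
  let ?P = "subtopology X {a}"
  have P: "topspace ?P = {a}"
    using a by auto
  have "rank_homology X \<le> rank_homology ?P"
    using a(2) by (intro rank_homology_le abelian_rank_iso abelian_homology_group
        homotopy_equivalent_space_imp_isomorphic_homology_groups)
  \<comment> \<open>The homology of a point is concentrated in degree 0.\<close>
  also have "\<dots> = (\<Sum>p\<in>{0::nat}. ennreal_of_enat (abelian_rank (homology_group (int p) ?P)))"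
    unfolding rank_homology_def
    by (intro suminf_finite)
      (auto simp: abelian_rank_trivial abelian_homology_group homology_dimension_axiom[OF P])
  also have "\<dots> \<le> ennreal_of_enat 1"
  proof -
    have "abelian_rank (homology_group 0 ?P) \<le> abelian_rank integer_group"
      by (intro abelian_rank_iso abelian_homology_group abelian_integer_group homology_coefficients[OF P])
    also have "\<dots> \<le> 1"
      by (rule abelian_rank_integer_group)
    finally show ?thesis
      by (simp del: ennreal_of_enat_1)
  qed
  finally show ?thesis by simp
qed

text \<open>
  Excision replaces the pair \<open>(A \<union> B, B)\<close> by \<open>(A, A \<inter> B)\<close>, so the two long exact sequences of
  pairs give the rank inequality of the Mayer--Vietoris sequence without its boundary map.
\<close>

lemma abelian_rank_Un:
  assumes "openin X A" "openin X B" "A \<union> B = topspace X"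
  shows "abelian_rank (homology_group p X) \<le> abelian_rank (homology_group p (subtopology X B))
    + (abelian_rank (homology_group p (subtopology X A))
      + abelian_rank (homology_group (p - 1) (subtopology X (A \<inter> B))))"
proof -
  \<comment> \<open>Exactness at the middle of H_p(B) -> H_p(X) -> H_p(X, B).\<close>
  have 1: "abelian_rank (homology_group p X) \<le> abelian_rank (homology_group p (subtopology X B))
      + abelian_rank (relative_homology_group p X B)"
    using homology_exactness_axiom_3[of p X B]
    by (intro abelian_rank_exact[OF _ _ _ hom_induced_hom hom_induced_hom]) auto
  have 2: "abelian_rank (relative_homology_group p X B)
      \<le> abelian_rank (relative_homology_group p (subtopology X A) (A \<inter> B))"
  proof -
    \<comment> \<open>The excised set is \<open>B - A\<close>, the complement of \<open>A\<close>:
      it is closed and lies in the open set \<open>B\<close>.\<close>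
    have B: "B - (B - A) = A \<inter> B" "topspace X - (B - A) = A"
      unfolding assms(3)[symmetric] by blast+
    have "closedin X (topspace X - A)"
      using assms(1) by (simp add: closedin_diff)
    moreover have "topspace X - A = B - A"
      using assms(3) by blast
    ultimately have "X closure_of (B - A) = B - A"
      by (metis closure_of_closedin)
    then have "X closure_of (B - A) \<subseteq> X interior_of B"
      unfolding interior_of_openin[OF assms(2)] by blast
    from homology_excision_axiom[OF this openin_subset[OF assms(2)]]
    have "hom_induced p (subtopology X A) (A \<inter> B) X B id
        \<in> iso (relative_homology_group p (subtopology X A) (A \<inter> B)) (relative_homology_group p X B)"
      by (simp only: B subtopology_topspace)
    then have "relative_homology_group p X B
        \<cong> relative_homology_group p (subtopology X A) (A \<inter> B)"
      by (rule group.iso_sym[OF group_relative_homology_group is_isoI])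
    then show ?thesis
      by (intro abelian_rank_iso) auto
  qed
  \<comment> \<open>Exactness at the middle of H_p(A) -> H_p(A, A Int B) -> H_{p-1}(A Int
    B).\<close>
  have 3: "abelian_rank (relative_homology_group p (subtopology X A) (A \<inter> B))
      \<le> abelian_rank (homology_group p (subtopology X A))
        + abelian_rank (homology_group (p - 1) (subtopology (subtopology X A) (A \<inter> B)))"
    using homology_exactness_axiom_1[of p "subtopology X A" "A \<inter> B"]
    by (intro abelian_rank_exact[OF _ _ _ hom_induced_hom hom_boundary_hom]) auto
  have 4: "subtopology (subtopology X A) (A \<inter> B) = subtopology X (A \<inter> B)"
    by (simp add: subtopology_subtopology)
  show ?thesis
    by (rule order_trans[OF 1 add_left_mono[OF order_trans[OF 2 3[unfolded 4]]]])
qed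

lemma rank_homology_Un:
  assumes "openin X A" "openin X B" "A \<union> B = topspace X"
  shows "rank_homology X \<le> rank_homology (subtopology X A) + rank_homology (subtopology X B)
    + rank_homology (subtopology X (A \<inter> B))"
proof -
  define r where "r Y p = ennreal_of_enat (abelian_rank (homology_group p Y))" for Y :: "'a topology" and p
  have rank: "rank_homology Y = suminf (\<lambda>p. r Y (int p))" for Y
    by (simp add: rank_homology_def r_def)
  \<comment> \<open>The shifted series has one extra term, in degree -1, and that term
    vanishes.\<close>
  have shift: "suminf (\<lambda>p. r Y (int p - 1)) = rank_homology Y" for Y
  proof -
    have "r Y (- 1) = 0"
      by (simp add: r_def abelian_rank_trivial)
    then show ?thesis
      using suminf_offset[of "\<lambda>p. r Y (int p - 1)" 1] by (simp add: rank)
  qed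
  have le: "r X p \<le> r (subtopology X A) p + r (subtopology X B) p + r (subtopology X (A \<inter> B)) (p - 1)" for p
  proof -
    have "r X p \<le> ennreal_of_enat (abelian_rank (homology_group p (subtopology X B))
      + (abelian_rank (homology_group p (subtopology X A))
      + abelian_rank (homology_group (p - 1) (subtopology X (A \<inter> B)))))"
      unfolding r_def using abelian_rank_Un[OF assms] by (simp del: ennreal_of_enat_plus)
    then show ?thesis
      by (simp add: r_def ac_simps)
  qed
  have "rank_homology X \<le> suminf (\<lambda>p. r (subtopology X A) (int p) + r (subtopology X B) (int p)
      + r (subtopology X (A \<inter> B)) (int p - 1))"
    unfolding rank by (intro suminf_le le) auto
  also have "\<dots> = rank_homology (subtopology X A) + rank_homology (subtopology X B)
      + rank_homology (subtopology X (A \<inter> B))"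
    by (simp add: suminf_add[symmetric] shift rank)
  finally show ?thesis .
qed

section \<open>Total Betti numbers of unions of convex open sets\<close>

corollary rank_homology_top_of_set_Un:
  assumes "open A" "open B"
  shows "rank_homology (top_of_set (A \<union> B))
    \<le> rank_homology (top_of_set A) + rank_homology (top_of_set B) + rank_homology (top_of_set (A \<inter> B))"
proof -
  have "openin (top_of_set (A \<union> B)) A" "openin (top_of_set (A \<union> B)) B"
    using assms by (auto simp: openin_open)
  then have "rank_homology (top_of_set (A \<union> B))
    \<le> rank_homology (subtopology (top_of_set (A \<union> B)) A) + rank_homology (subtopology (top_of_set (A \<union> B)) B)
      + rank_homology (subtopology (top_of_set (A \<union> B)) (A \<inter> B))"
    by (intro rank_homology_Un) auto
  moreover have "(A \<union> B) \<inter> A = A" "(A \<union> B) \<inter> B = B" "(A \<union> B) \<inter> (A \<inter> B) = A \<inter> B"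
    by auto
  ultimately show ?thesis
    by (simp add: subtopology_subtopology)
qed

lemma rank_homology_convex:
  fixes S :: "'a::real_normed_vector set"
  assumes "convex S"
  shows "rank_homology (top_of_set S) \<le> 1"
  using assms by (simp add: rank_homology_contractible convex_imp_contractible)

text \<open>Intersecting the earlier sets with \<open>U k\<close> gives another convex open family
  over \<open>I\<close>, which is why the induction varies \<open>U\<close>. With b the total Betti
  number, the summand 1 closes the recursion: b + 1 at most doubles with each new set.\<close>

lemma rank_homology_UN_convex:
  fixes U :: "'i \<Rightarrow> 'a::real_normed_vector set"
  assumes "finite I" "\<And>i. i \<in> I \<Longrightarrow> open (U i)" "\<And>i. i \<in> I \<Longrightarrow> convex (U i)"
  shows "rank_homology (top_of_set (\<Union>i\<in>I. U i)) + 1 \<le> 2 ^ card I"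
  using assms
proof (induction I arbitrary: U)
  case empty
  show ?case by (simp add: rank_homology_empty)
next
  case (insert k I)
  let ?r = "\<lambda>S. rank_homology (top_of_set S)"
  let ?V = "\<Union>i\<in>I. U i"
  have "U k \<inter> ?V = (\<Union>i\<in>I. U k \<inter> U i)"
    by auto
  moreover have "?r (\<Union>i\<in>I. U k \<inter> U i) + 1 \<le> 2 ^ card I"
    using insert.prems by (intro insert.IH) (auto intro: convex_Int)
  ultimately have inter: "?r (U k \<inter> ?V) + 1 \<le> 2 ^ card I"
    by simp
  have "?r (U k \<union> ?V) + 1 \<le> (?r (U k) + ?r ?V + ?r (U k \<inter> ?V)) + 1"
    using insert.prems by (intro add_mono rank_homology_top_of_set_Un) auto
  also have "\<dots> \<le> (1 + ?r ?V + ?r (U k \<inter> ?V)) + 1"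
    using insert.prems by (intro add_mono rank_homology_convex) auto
  also have "\<dots> = (?r ?V + 1) + (?r (U k \<inter> ?V) + 1)"
    by (simp add: ac_simps)
  also have "\<dots> \<le> 2 ^ card I + 2 ^ card I"
    using insert.prems by (intro add_mono inter insert.IH) auto
  also have "\<dots> = 2 ^ card (insert k I)"
    using insert.hyps by (simp add: mult_2)
  finally show ?case by simp
qed

text \<open>A new set meets the earlier union in a union of at most \<open>D\<close> convex open
  sets, of total rank at most 2^D - 1. Together with its own rank, at most 1, it adds at most 2^D,
  so the bound is linear in the number of sets.\<close>

lemma rank_homology_UN_convex_bounded_overlap:
  fixes U :: "'i \<Rightarrow> 'a::real_normed_vector set"
  assumes "finite I" "\<And>i. i \<in> I \<Longrightarrow> open (U i)" "\<And>i. i \<in> I \<Longrightarrow> convex (U i)"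
    and "\<And>k. k \<in> I \<Longrightarrow> card {i\<in>I. U k \<inter> U i \<noteq> {}} \<le> D"
  shows "rank_homology (top_of_set (\<Union>i\<in>I. U i)) \<le> of_nat (card I) * 2 ^ D"
  using assms
proof (induction I)
  case empty
  show ?case by (simp add: rank_homology_empty)
next
  case (insert k I)
  let ?r = "\<lambda>S. rank_homology (top_of_set S)"
  let ?V = "\<Union>i\<in>I. U i"
  let ?N = "{i\<in>I. U k \<inter> U i \<noteq> {}}"
  have overlap: "card {i\<in>I. U j \<inter> U i \<noteq> {}} \<le> D" if "j \<in> insert k I" for j
  proof -
    have "card {i\<in>I. U j \<inter> U i \<noteq> {}} \<le> card {i\<in>insert k I. U j \<inter> U i \<noteq> {}}"
      using insert.hyps by (intro card_mono) auto
    then show ?thesis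
      using insert.prems(3)[OF that] by simp
  qed
  have "U k \<inter> ?V = (\<Union>i\<in>?N. U k \<inter> U i)"
    by auto
  moreover have "?r (\<Union>i\<in>?N. U k \<inter> U i) + 1 \<le> 2 ^ card ?N"
    using insert.prems insert.hyps by (intro rank_homology_UN_convex) (auto intro: convex_Int)
  moreover have "(2::ennreal) ^ card ?N \<le> 2 ^ D"
    using overlap[of k] by (intro power_increasing) auto
  ultimately have inter: "?r (U k \<inter> ?V) + 1 \<le> 2 ^ D"
    by simp
  have "?r (U k \<union> ?V) \<le> ?r (U k) + ?r ?V + ?r (U k \<inter> ?V)"
    using insert.prems by (intro rank_homology_top_of_set_Un) auto
  also have "\<dots> \<le> 1 + ?r ?V + ?r (U k \<inter> ?V)"
    using insert.prems by (intro add_mono rank_homology_convex) auto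
  also have "\<dots> = ?r ?V + (?r (U k \<inter> ?V) + 1)"
    by (simp add: ac_simps)
  also have "\<dots> \<le> of_nat (card I) * 2 ^ D + 2 ^ D"
    using insert.prems overlap by (intro add_mono inter insert.IH) auto
  also have "\<dots> = of_nat (card (insert k I)) * 2 ^ D"
    using insert.hyps by (simp add: algebra_simps)
  finally show ?case by simp
qed


section \<open>Covering by grid boxes\<close>

lemma open_open_neighborhood: "open (open_neighborhood T X)"
proof (cases "X = {}")
  case False
  then have "open_neighborhood T X = (\<lambda>y. infdist y X) -` {..<T}"
    by (auto simp: open_neighborhood_def)
  then show ?thesis
    by (simp add: continuous_on_infdist continuous_on_id open_vimage)
qed (simp add: open_neighborhood_def)

text \<open>The retraction of \<open>N\<close> onto \<open>X\<close> restricts to any intermediate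
  \<open>U\<close>.\<close>

lemma rank_homology_le_of_retract_of:
  assumes "X retract_of N" "X \<subseteq> U" "U \<subseteq> N"
  shows "rank_homology (top_of_set X) \<le> rank_homology (top_of_set U)"
proof -
  obtain r where "continuous_on N r" "r \<in> N \<rightarrow> X" "\<forall>x\<in>X. r x = x"
    using assms(1) by (auto simp: retract_of_def retraction_def)
  then have "continuous_map (top_of_set U) (top_of_set X) r"
    using assms(3) by (auto intro: continuous_on_subset)
  moreover have UX: "subtopology (top_of_set U) X = top_of_set X"
    using assms(2) by (simp add: subtopology_subtopology Int_absorb1)
  ultimately have "X retract_of_space (top_of_set U)"
    using assms(2) \<open>\<forall>x\<in>X. r x = x\<close> by (auto simp: retract_of_space_def)
  from rank_homology_retract[OF this] show ?thesis
    by (simp only: UX)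
qed

text \<open>
  \<open>grid_box s 0 z\<close> is the open cell of the grid of mesh \<open>s\<close> with lower corner \<open>s z\<close>;
  \<open>grid_box s r z\<close> enlarges it by \<open>r s\<close> on every side.
\<close>

definition grid_box :: "real \<Rightarrow> real \<Rightarrow> int ^ 'n \<Rightarrow> (real ^ 'n) set"
  where "grid_box s r z = box (\<chi> i. s * (real_of_int (z $ i) - r)) (\<chi> i. s * (real_of_int (z $ i) + 1 + r))"

lemma mem_grid_box:
  "x \<in> grid_box s r z \<longleftrightarrow> (\<forall>i. s * (real_of_int (z $ i) - r) < x $ i \<and> x $ i < s * (real_of_int (z $ i) + 1 + r))"
  by (simp add: grid_box_def mem_box_cart)

lemma emeasure_grid_box_0:
  fixes z :: "int ^ 'n"
  assumes "s > 0"
  shows "emeasure lborel (grid_box s 0 z) = ennreal (s ^ CARD('n))"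
proof -
  let ?l = "\<chi> i. s * (real_of_int (z $ i) - 0)" and ?u = "\<chi> i. s * (real_of_int (z $ i) + 1 + 0)"
  have side: "(?u - ?l) \<bullet> b = s" if "b \<in> Basis" for b
    using that by (auto simp: Basis_vec_def inner_axis algebra_simps)
  then have "emeasure lborel (box ?l ?u) = (\<Prod>b\<in>Basis. (?u - ?l) \<bullet> b)"
    using assms by (intro emeasure_lborel_box) (metis inner_diff_left diff_ge_0_iff_ge less_imp_le)
  also have "(\<Prod>b\<in>Basis. (?u - ?l) \<bullet> b) = s ^ CARD('n)"
    using side by (simp cong: prod.cong)
  finally show ?thesis
    by (simp add: grid_box_def)
qed

text \<open>In each coordinate, a common point makes each of the two integers smaller than the other
  plus one.\<close>

lemma grid_box_0_disjoint:
  assumes "s > 0" "x \<in> grid_box s 0 z" "x \<in> grid_box s 0 w"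
  shows "z = w"
proof -
  have "z $ i = w $ i" for i
  proof -
    have "s * z $ i < s * (w $ i + 1)" "s * w $ i < s * (z $ i + 1)"
      using assms(2,3) by (auto simp: mem_grid_box intro: less_trans)
    then have "real_of_int (z $ i) < w $ i + 1" "real_of_int (w $ i) < z $ i + 1"
      using assms(1) by (simp_all only: mult_less_cancel_left_pos)
    then show ?thesis by linarith
  qed
  then show ?thesis by (simp add: vec_eq_iff)
qed

text \<open>Each side of an enlarged box has length 3s, so the corners of two meeting boxes differ
  by less than 3 in every integer coordinate. The difference vector thus has at most 5 values per
  coordinate, and it determines \<open>w\<close>.\<close>

lemma card_grid_box_1_overlap:
  fixes z :: "int ^ 'n"
  assumes "s > 0"
  shows "card {w\<in>Z. grid_box s 1 z \<inter> grid_box s 1 w \<noteq> {}} \<le> 5 ^ CARD('n)"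
proof -
  let ?W = "{w\<in>Z. grid_box s 1 z \<inter> grid_box s 1 w \<noteq> {}}"
  let ?F = "(UNIV :: 'n set) \<rightarrow>\<^sub>E {-2..2::int}"
  have "w $ i - z $ i \<in> {-2..2}" if w: "w \<in> ?W" for w i
  proof -
    obtain x where "x \<in> grid_box s 1 z" "x \<in> grid_box s 1 w"
      using w by auto
    then have "s * (z $ i - 1) < x $ i" "x $ i < s * (w $ i + 2)"
        "s * (w $ i - 1) < x $ i" "x $ i < s * (z $ i + 2)"
      by (auto simp: mem_grid_box add.commute)
    then have "s * (z $ i - 1) < s * (w $ i + 2)" "s * (w $ i - 1) < s * (z $ i + 2)"
      by (metis less_trans)+
    then have "real_of_int (z $ i) - 1 < w $ i + 2" "real_of_int (w $ i) - 1 < z $ i + 2"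
      using assms by (simp_all only: mult_less_cancel_left_pos)
    then have "- 2 \<le> w $ i - z $ i" "w $ i - z $ i \<le> 2"
      by linarith+
    then show ?thesis by simp
  qed
  then have maps: "(\<lambda>w i. w $ i - z $ i) ` ?W \<subseteq> ?F"
    by (intro image_subsetI PiE_I) auto
  have inj: "inj_on (\<lambda>w i. w $ i - z $ i) ?W"
    by (auto simp: inj_on_def fun_eq_iff vec_eq_iff)
  have "finite ?F"
    by (intro finite_PiE) auto
  then have "card ?W \<le> card ?F"
    by (rule card_inj_on_le[OF inj maps])
  then show ?thesis
    by (simp add: card_PiE)
qed

text \<open>This fixes the mesh: \<open>x\<close> lies in the half-open cell and \<open>y\<close> at
  most one mesh width outside it, so each coordinate differs by less than 2s and the l1 distance is
  below 2ns = \<open>T\<close>.\<close>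

lemma grid_box_1_subset_neighborhood:
  fixes x :: "real ^ 'n"
  assumes "T > 0" "x \<in> X" "s = T / (2 * CARD('n))"
  shows "grid_box s 1 (\<chi> i. \<lfloor>x $ i / s\<rfloor>) \<subseteq> open_neighborhood T X"
proof
  fix y assume y: "y \<in> grid_box s 1 (\<chi> i. \<lfloor>x $ i / s\<rfloor>)"
  have s: "s > 0"
    using assms by simp
  have "\<bar>(y - x) $ i\<bar> < 2 * s" for i
  proof -
    have "s * \<lfloor>x $ i / s\<rfloor> \<le> x $ i" "x $ i < s * (\<lfloor>x $ i / s\<rfloor> + 1)"
      using floor_divide_lower[OF s, of "x $ i"] floor_divide_upper[OF s, of "x $ i"]
      by (simp_all add: mult.commute)
    moreover have "s * (\<lfloor>x $ i / s\<rfloor> - 1) < y $ i" "y $ i < s * (\<lfloor>x $ i / s\<rfloor> + 2)"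
      using y by (auto simp: mem_grid_box add.commute)
    ultimately show ?thesis
      by (simp add: algebra_simps abs_less_iff)
  qed
  then have "(\<Sum>i\<in>UNIV. \<bar>(y - x) $ i\<bar>) < (\<Sum>i\<in>(UNIV::'n set). 2 * s)"
    by (intro sum_strict_mono) auto
  also have "\<dots> = T"
    using assms by simp
  finally have "dist y x < T"
    using norm_le_l1_cart[of "y - x"] by (simp add: dist_norm)
  moreover have "infdist y X \<le> dist y x"
    using assms(2) by (rule infdist_le)
  ultimately show "y \<in> open_neighborhood T X"
    using assms(2) by (auto simp: open_neighborhood_def)
qed

text \<open>The enlargement matters here: the open cell itself would miss points on the grid
  hyperplanes.\<close>

lemma mem_grid_box_1_floor:
  fixes x :: "real ^ 'n"
  assumes "s > 0"
  shows "x \<in> grid_box s 1 (\<chi> i. \<lfloor>x $ i / s\<rfloor>)"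
proof -
  have "s * (\<lfloor>x $ i / s\<rfloor> - 1) < x $ i \<and> x $ i < s * (\<lfloor>x $ i / s\<rfloor> + 1 + 1)" for i
  proof -
    have "\<lfloor>x $ i / s\<rfloor> - 1 < x $ i / s" "x $ i / s < \<lfloor>x $ i / s\<rfloor> + 1 + 1"
      by linarith+
    then show ?thesis
      using assms by (simp add: field_simps)
  qed
  then show ?thesis by (simp add: mem_grid_box)
qed

lemma card_grid_box_0_le_emeasure:
  fixes Z :: "(int ^ 'n) set"
  assumes "s > 0" "finite Z" "\<And>z. z \<in> Z \<Longrightarrow> grid_box s 0 z \<subseteq> N" "N \<in> sets lborel"
  shows "of_nat (card Z) * ennreal (s ^ CARD('n)) \<le> emeasure lborel N"
proof -
  have "of_nat (card Z) * ennreal (s ^ CARD('n)) = (\<Sum>z\<in>Z. emeasure lborel (grid_box s 0 z))"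
    using assms(1) by (simp add: emeasure_grid_box_0)
  also have "\<dots> = emeasure lborel (\<Union>z\<in>Z. grid_box s 0 z)"
    using assms(1,2) by (intro sum_emeasure)
      (auto simp: disjoint_family_on_def grid_box_def[of s 0] dest: grid_box_0_disjoint[unfolded grid_box_def])
  also have "\<dots> \<le> emeasure lborel N"
    using assms(3,4) by (intro emeasure_mono) auto
  finally show ?thesis .
qed

section \<open>Counting the boxes and assembling the estimate\<close>

theorem proposition3p3:
  shows "\<exists>C::real. \<forall>(X :: (real ^ 'n) set) (T::real).
    T > 0 \<and> cw_complex (top_of_set X) \<and> retraction_thickness_at_least T X \<longrightarrow>
    rank_homology (top_of_set X)
      \<le> ennreal C * emeasure lborel (open_neighborhood T X) * ennreal (T powi (- int CARD('n)))"
proof -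
  define n where "n = CARD('n)"
  define D :: nat where "D = 5 ^ n"
  \<comment> \<open>Each box contributes at most 2^D, with \<open>D\<close> the overlap bound. The
    factor (2n)^n comes from s^(-n) = (2n)^n T^(-n).\<close>
  define C :: real where "C = 2 ^ D * (2 * n) ^ n"
  have n: "n > 0" by (simp add: n_def)
  then have C: "C > 0" by (simp add: C_def)
  have "rank_homology (top_of_set X)
      \<le> ennreal C * emeasure lborel (open_neighborhood T X) * ennreal (T powi (- int n))"
    if T: "T > 0" and retract: "X retract_of open_neighborhood T X" for X :: "(real ^ 'n) set" and T
  proof (cases "emeasure lborel (open_neighborhood T X) = \<infinity>")
    \<comment> \<open>Since \<open>C\<close> and the power of \<open>T\<close> are positive, the
      right-hand side is infinite; a zero factor would make the product 0 in
      \<open>ennreal\<close>.\<close>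
    case True
    then show ?thesis
      using C T by (simp add: ennreal_mult_top ennreal_top_mult)
  next
    case False
    define N where "N = open_neighborhood T X"
    define s where "s = T / (2 * n)"
    have s: "s > 0" using T n by (simp add: s_def)
    define Z where "Z = (\<lambda>x. \<chi> i. \<lfloor>x $ i / s\<rfloor>) ` X"
    let ?U = "\<Union>z\<in>Z. grid_box s 1 z"
    have U: "grid_box s 1 z \<subseteq> N" if "z \<in> Z" for z
      using that grid_box_1_subset_neighborhood[OF T, of _ X s] by (auto simp: Z_def N_def s_def n_def)
    have "grid_box s 0 z \<subseteq> grid_box s 1 z" for z :: "int ^ 'n"
    proof
      fix x assume x: "x \<in> grid_box s 0 z"
      have "s * (z $ i - 1) < s * z $ i" "s * (z $ i + 1) < s * (z $ i + 1 + 1)" for i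
        using s by (simp_all only: mult_less_cancel_left_pos)
      then show "x \<in> grid_box s 1 z"
        using x by (auto simp: mem_grid_box intro: less_trans)
    qed
    \<comment> \<open>Stated for finite subsets: \<open>Z\<close> is not yet known to be finite, and
      \<open>card\<close> of an infinite set is 0.\<close>
    then have volume: "of_nat (card F) * ennreal (s ^ n) \<le> emeasure lborel N" if "finite F" "F \<subseteq> Z" for F
      using U that s unfolding n_def
      by (intro card_grid_box_0_le_emeasure) (auto simp: N_def open_open_neighborhood)
    have card: "of_nat (card F) \<le> emeasure lborel N * ennreal (1 / s ^ n)" if "finite F" "F \<subseteq> Z" for F
    proof -
      have "of_nat (card F) = of_nat (card F) * ennreal (s ^ n) * ennreal (1 / s ^ n)"
        using s by (simp add: mult.assoc ennreal_mult[symmetric])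
      also have "\<dots> \<le> emeasure lborel N * ennreal (1 / s ^ n)"
        using volume[OF that] by (rule mult_right_mono) simp
      finally show ?thesis .
    qed
    \<comment> \<open>\<open>X\<close> is not assumed bounded. Finiteness comes from the volume,
      which bounds the size of all finite subsets of \<open>Z\<close> uniformly.\<close>
    have "finite Z"
    proof -
      have "emeasure lborel N * ennreal (1 / s ^ n) < \<infinity>"
        using False by (simp add: N_def ennreal_mult_less_top less_top)
      then obtain m :: nat where m: "emeasure lborel N * ennreal (1 / s ^ n) < of_nat m"
        using ennreal_Ex_less_of_nat by (auto simp: less_top)
      have "card F \<le> m" if "F \<subseteq> Z" "finite F" for F
        using le_less_trans[OF card[OF that(2,1)] m] by (simp add: less_imp_le)
      then show ?thesis
        using finite_if_finite_subsets_card_bdd[of Z m] by blast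
    qed
    have "X \<subseteq> ?U"
      using mem_grid_box_1_floor[OF s] by (fastforce simp: Z_def)
    then have "rank_homology (top_of_set X) \<le> rank_homology (top_of_set ?U)"
      using U by (intro rank_homology_le_of_retract_of[OF retract]) (auto simp: N_def)
    also have "\<dots> \<le> of_nat (card Z) * 2 ^ D"
      using \<open>finite Z\<close> unfolding D_def n_def
      by (intro rank_homology_UN_convex_bounded_overlap card_grid_box_1_overlap s)
        (auto simp: grid_box_def)
    also have "\<dots> \<le> emeasure lborel N * ennreal (1 / s ^ n) * 2 ^ D"
      using card[OF \<open>finite Z\<close>] by (intro mult_right_mono) auto
    also have "\<dots> = ennreal C * emeasure lborel N * ennreal (T powi (- int n))"
    proof -
      have "1 / s ^ n * 2 ^ D = C * T powi (- int n)"
        using T n by (simp add: s_def C_def power_int_minus field_simps)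
      moreover have "(2::ennreal) ^ D = ennreal (2 ^ D)"
        by (simp add: ennreal_power[symmetric])
      ultimately have "ennreal (1 / s ^ n) * 2 ^ D = ennreal C * ennreal (T powi (- int n))"
        using s T C by (simp add: ennreal_mult[symmetric] del: times_divide_eq_left)
      then show ?thesis
        by (simp add: ac_simps)
    qed
    finally show ?thesis
      by (simp add: N_def)
  qed
  then show ?thesis
    unfolding n_def retraction_thickness_at_least_def by blast
qed

end
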